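(* Let $x\in\mathbb R^d$ and $k\in\mathbb N$, let $v\sim\gamma$ and $I\sim\mathrm{Unif}(\mathfrak I_0(k))$ be the velocity and index orbit, and let $W\sim\mathrm{Unif}([0,1])$ be independent of $(v,I)$. Define the event $$A_{\mathrm{index}}(x)=\Bigl\{W\le |I|\,\min_{i\in I}e^{-(H\circ\Phi_h^i-H)(x,v)}\Bigl(\sum_{i\in I}e^{-(H\circ\Phi_h^i-H)(x,v)}\Bigr)^{-1}\Bigr\}.$$ Then Multinoulli HMC can be written as $$\pi_{\mathrm{MultHMC}}(x,\cdot)\,\mathbf 1_{A_{\mathrm{index}}(x)}=\pi_{\mathrm{UnifHMC}}(x,\cdot)\,\mathbf 1_{A_{\mathrm{index}}(x)}.$$
   Context: $\mathbb N=\{0,1,2,\dots\}$; $\gamma$ is the standard Gaussian measure on $\mathbb R^d$. The target is $\mu(dx)\propto e^{-U(x)}dx$ with $U:\mathbb R^d\to\mathbb R$ continuously differentiable, and $H(x,v)=U(x)+|v|^2/2$ on $\mathbb R^{2d}$. For $h>0$, one leapfrog step is $\Phi_h(x,v)=(x',v')$ with $x'=x+h\bigl(v-\tfrac h2\nabla U(x)\bigr)$, $v'=v-\tfrac h2\nabla U(x)-\tfrac h2\nabla U(x')$; $\Phi_h^L$, $L\in\mathbb Z$, is its $L$-th iterate (negative $L$: iterates of the inverse). $\Pi(x,v)=x$. An index orbit is a set of consecutive integers whose length is a power of two ($1,2,4,\dots$); $\mathfrak I_0(k)$ is the collection of index orbits of length $2^k$ containing $0$. Multinoulli HMC, $X\sim\pi_{\mathrm{MultHMC}}(x,\cdot)$: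 draw $v\sim\gamma$; draw $I\sim\mathrm{Unif}(\mathfrak I_0(k))$ independently; draw $L\in I$ with $\mathbb P(L=i)\propto e^{-(H\circ\Phi_h^i-H)(x,v)}$, $i\in I$; output $X=\Pi(\Phi_h^L(x,v))$. Uniform HMC, $X\sim\pi_{\mathrm{UnifHMC}}(x,\cdot)$: the same with the third step replaced by $L\sim\mathrm{Unif}(I)$. The notation $\pi(x,\cdot)\mathbf 1_A=\pi'(x,\cdot)\mathbf 1_A$ means that transitions $X\sim\pi(x,\cdot)$ and $X'\sim\pi'(x,\cdot)$ can be realized on a common probability space carrying the event $A$ (here: with the same $v$, $I$ and with the variable $W$) such that $X=X'$ on $A$. *)

theory Defs
  imports "HOL-Probability.Probability"
begin

definition grad :: "((real ^ 'd) \<Rightarrow> real) \<Rightarrow> real ^ 'd \<Rightarrow> real ^ 'd" where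
  "grad U x = (THE D. GDERIV U x :> D)"

definition std_gaussian :: "(real ^ 'd) measure" where
  "std_gaussian = density lborel (\<lambda>v. ennreal (\<Prod>i\<in>UNIV. std_normal_density (v $ i)))"

definition hamiltonian :: "((real ^ 'd) \<Rightarrow> real) \<Rightarrow> (real ^ 'd) \<times> (real ^ 'd) \<Rightarrow> real" where
  "hamiltonian U = (\<lambda>(x, v). U x + (norm v)\<^sup>2 / 2)"

definition leapfrog ::
  "((real ^ 'd) \<Rightarrow> real) \<Rightarrow> real \<Rightarrow> (real ^ 'd) \<times> (real ^ 'd) \<Rightarrow> (real ^ 'd) \<times> (real ^ 'd)" where
  "leapfrog U h = (\<lambda>(x, v).
     let x' = x + h *\<^sub>R (v - (h / 2) *\<^sub>R grad U x);
         v' = v - (h / 2) *\<^sub>R grad U x - (h / 2) *\<^sub>R grad U x'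
     in (x', v'))"

text \<open>The leapfrog map is a bijection for every \<open>U\<close> and \<open>h\<close> (it is a composition of shears),
  so the function \<open>inv\<close> below is its two-sided inverse.\<close>

definition leapfrog_iter ::
  "((real ^ 'd) \<Rightarrow> real) \<Rightarrow> real \<Rightarrow> int \<Rightarrow> (real ^ 'd) \<times> (real ^ 'd) \<Rightarrow> (real ^ 'd) \<times> (real ^ 'd)" where
  "leapfrog_iter U h i =
     (if 0 \<le> i then leapfrog U h ^^ nat i else inv (leapfrog U h) ^^ nat (- i))"

definition index_orbit :: "int set \<Rightarrow> bool" where
  "index_orbit I \<longleftrightarrow> (\<exists>a. \<exists>m::nat. I = {a..<a + 2 ^ m})"

definition index_orbits0 :: "nat \<Rightarrow> int set set" where
  "index_orbits0 k = {I. index_orbit I \<and> card I = 2 ^ k \<and> 0 \<in> I}"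

definition boltzmann_weight ::
  "((real ^ 'd) \<Rightarrow> real) \<Rightarrow> real \<Rightarrow> real ^ 'd \<Rightarrow> real ^ 'd \<Rightarrow> int \<Rightarrow> real" where
  "boltzmann_weight U h x v i =
     exp (- (hamiltonian U (leapfrog_iter U h i (x, v)) - hamiltonian U (x, v)))"

text \<open>Only meaningful for finite nonempty \<open>I\<close> and \<open>w\<close> positive on \<open>I\<close>, the only case in which it
  matters: the law on \<open>I\<close> with probabilities proportional to \<open>w\<close>.\<close>

definition multinoulli_pmf :: "('i \<Rightarrow> real) \<Rightarrow> 'i set \<Rightarrow> 'i pmf" where
  "multinoulli_pmf w I = embed_pmf (\<lambda>i. if i \<in> I then w i / (\<Sum>j\<in>I. w j) else 0)"

text \<open>The joint law of \<open>(v, I, L)\<close>: \<open>v\<close> is Gaussian, \<open>I\<close> is uniform on \<open>index_orbits0 k\<close>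
  independently of \<open>v\<close>, and given \<open>(v, I)\<close> the index \<open>L\<close> has law \<open>sel v I\<close>.\<close>

definition hmc_draw ::
  "(real ^ 'd \<Rightarrow> int set \<Rightarrow> int pmf) \<Rightarrow> nat \<Rightarrow> ((real ^ 'd) \<times> int set \<times> int) measure" where
  "hmc_draw sel k = std_gaussian \<bind> (\<lambda>v.
     distr (measure_pmf (bind_pmf (pmf_of_set (index_orbits0 k))
                          (\<lambda>I. map_pmf (\<lambda>L. (I, L)) (sel v I))))
       (borel \<Otimes>\<^sub>M count_space UNIV \<Otimes>\<^sub>M count_space UNIV)
       (\<lambda>(I, L). (v, I, L)))"

definition mult_hmc_draw ::
  "((real ^ 'd) \<Rightarrow> real) \<Rightarrow> real \<Rightarrow> nat \<Rightarrow> real ^ 'd \<Rightarrow> ((real ^ 'd) \<times> int set \<times> int) measure" where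
  "mult_hmc_draw U h k x = hmc_draw (\<lambda>v I. multinoulli_pmf (boltzmann_weight U h x v) I) k"

definition unif_hmc_draw :: "nat \<Rightarrow> ((real ^ 'd) \<times> int set \<times> int) measure" where
  "unif_hmc_draw k = hmc_draw (\<lambda>v I. pmf_of_set I) k"

definition hmc_output ::
  "((real ^ 'd) \<Rightarrow> real) \<Rightarrow> real \<Rightarrow> real ^ 'd \<Rightarrow> real ^ 'd \<Rightarrow> int \<Rightarrow> real ^ 'd" where
  "hmc_output U h x v L = fst (leapfrog_iter U h L (x, v))"

definition mult_hmc ::
  "((real ^ 'd) \<Rightarrow> real) \<Rightarrow> real \<Rightarrow> nat \<Rightarrow> real ^ 'd \<Rightarrow> (real ^ 'd) measure" where
  "mult_hmc U h k x = distr (mult_hmc_draw U h k x) borel (\<lambda>(v, I, L). hmc_output U h x v L)"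

definition unif_hmc ::
  "((real ^ 'd) \<Rightarrow> real) \<Rightarrow> real \<Rightarrow> nat \<Rightarrow> real ^ 'd \<Rightarrow> (real ^ 'd) measure" where
  "unif_hmc U h k x = distr (unif_hmc_draw k) borel (\<lambda>(v, I, L). hmc_output U h x v L)"

definition index_threshold ::
  "((real ^ 'd) \<Rightarrow> real) \<Rightarrow> real \<Rightarrow> real ^ 'd \<Rightarrow> real ^ 'd \<Rightarrow> int set \<Rightarrow> real" where
  "index_threshold U h x v I =
     real (card I) * (MIN i\<in>I. boltzmann_weight U h x v i)
       * inverse (\<Sum>i\<in>I. boltzmann_weight U h x v i)"

text \<open>\<open>agree_on M A P X Q Y\<close>: the variables \<open>X\<close> and \<open>Y\<close> realize the laws \<open>P\<close> and \<open>Q\<close> on the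
  common probability space \<open>M\<close> and coincide on the event \<open>A\<close>.\<close>

definition agree_on ::
  "'w measure \<Rightarrow> 'w set \<Rightarrow> 'a measure \<Rightarrow> ('w \<Rightarrow> 'a) \<Rightarrow> 'a measure \<Rightarrow> ('w \<Rightarrow> 'a) \<Rightarrow> bool" where
  "agree_on M A P X Q Y \<longleftrightarrow>
     prob_space M \<and> A \<in> sets M \<and>
     X \<in> measurable M P \<and> distr M P X = P \<and>
     Y \<in> measurable M Q \<and> distr M Q Y = Q \<and>
     (\<forall>\<omega>\<in>A. X \<omega> = Y \<omega>)"

end

theory Submission
  imports Defs
begin

text \<open>
  Fix the velocity \<open>v\<close> and the orbit \<open>I\<close>, and write \<open>w\<close> for the Boltzmann weights along \<open>I\<close>, with
  sum \<open>S\<close> and minimum \<open>m\<close>. The multinoulli law gives the index \<open>i\<close> mass \<open>w i / S\<close>, the uniform law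
  gives it \<open>1 / |I|\<close>. The number \<open>p = |I| m / S\<close> in the definition of the event is the largest
  one for which \<open>p / |I| \<le> w i / S\<close> for all \<open>i\<close>; so the multinoulli law is a mixture: with
  probability \<open>p\<close> it is the uniform law, and with probability \<open>1 - p\<close> it is the normalized
  remainder \<open>(w i - m) / (S - |I| m)\<close>, here called the residual law. This decomposition is
  lemma \<open>overlap_residual_mixture\<close>.

  The coupling follows from it. Draw \<open>v\<close>, \<open>I\<close> and \<open>W\<close> as prescribed and, given \<open>(v, I)\<close> and
  independently of \<open>W\<close>, a uniform index \<open>j\<close> and a residual index \<open>i\<close>. Uniform HMC uses \<open>j\<close>;
  multinoulli HMC uses \<open>j\<close> when \<open>W \<le> p\<close> and \<open>i\<close> otherwise. On the event \<open>W \<le> p\<close> both indices, hence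
  both outputs, coincide by construction. As \<open>W\<close> is uniform on \<open>[0, 1]\<close> and independent of
  \<open>(i, j)\<close>, the index of multinoulli HMC has the mixture law, that is, the multinoulli law.

  The rest is measure theory. The coupling is realized by a density on the product of the
  Gaussian, the finite set of orbits, the unit interval and two copies of the finite set of
  possible indices; three integral formulas for this density
  (\<open>nn_integral_coupling_base\<close>, \<open>nn_integral_coupling_uniform\<close>,
  \<open>nn_integral_coupling_multinoulli\<close>) give the three joint laws. They are compared with the laws
  of the two algorithms, which are defined as a Gaussian mixture over \<open>v\<close>, through
  \<open>emeasure_hmc_draw\<close>. Weights and outputs have to be measurable functions of \<open>v\<close> for this; they
  are even continuous, since \<open>U\<close>, \<open>grad U\<close> and with them the leapfrog map and its inverse are.
\<close>

section \<open>Splitting a uniform component off a multinoulli law\<close>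

text \<open>
  The largest \<open>p\<close> such that \<open>p\<close> times the uniform law on \<open>I\<close> lies below the law proportional
  to \<open>w\<close>.
\<close>

definition overlap :: "'i set \<Rightarrow> ('i \<Rightarrow> real) \<Rightarrow> real" where
  "overlap I w = real (card I) * (MIN i\<in>I. w i) * inverse (\<Sum>i\<in>I. w i)"

text \<open>
  What remains of the law proportional to \<open>w\<close> after the multiple \<open>overlap I w\<close> of the uniform law
  is removed, renormalized. When the weights are all equal nothing remains; the uniform law is
  taken as a substitute in that case, so that a probability law results for all positive weights.
\<close>

definition residual :: "'i set \<Rightarrow> ('i \<Rightarrow> real) \<Rightarrow> 'i \<Rightarrow> real" where
  "residual I w i =
     (if i \<notin> I then 0
      else if (\<Sum>j\<in>I. w j) = real (card I) * (MIN j\<in>I. w j) then 1 / real (card I)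
      else (w i - (MIN j\<in>I. w j)) / ((\<Sum>j\<in>I. w j) - real (card I) * (MIN j\<in>I. w j)))"

lemma card_Min_le_sum:
  fixes w :: "'i \<Rightarrow> real"
  assumes "finite I"
  shows "real (card I) * (MIN i\<in>I. w i) \<le> (\<Sum>i\<in>I. w i)"
  using sum_mono[of I "\<lambda>_. MIN i\<in>I. w i" w] assms by simp

context
  fixes I :: "'i set" and w :: "'i \<Rightarrow> real"
  assumes fin: "finite I" and ne: "I \<noteq> {}" and pos: "\<And>i. i \<in> I \<Longrightarrow> 0 < w i"
begin

lemma sum_weights_pos: "0 < (\<Sum>i\<in>I. w i)"
  using fin ne pos by (intro sum_pos) auto

lemma overlap_nonneg: "0 \<le> overlap I w"
proof -
  have "0 < (MIN i\<in>I. w i)" using fin ne pos by (subst Min_gr_iff) auto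
  then show ?thesis unfolding overlap_def using sum_weights_pos by simp
qed

lemma overlap_le_1: "overlap I w \<le> 1"
  using card_Min_le_sum[OF fin, of w] sum_weights_pos
  by (simp add: overlap_def field_simps)

lemma residual_nonneg: "0 \<le> residual I w i"
  using card_Min_le_sum[OF fin, of w] Min_le[of "w ` I" "w i"] fin
  by (auto simp: residual_def intro!: divide_nonneg_nonneg)

lemma sum_residual: "(\<Sum>i\<in>I. residual I w i) = 1"
proof (cases "(\<Sum>j\<in>I. w j) = real (card I) * (MIN j\<in>I. w j)")
  case True
  then show ?thesis using fin ne by (simp add: residual_def)
next
  case False
  then have "(\<Sum>i\<in>I. residual I w i) =
      (\<Sum>i\<in>I. (w i - (MIN j\<in>I. w j)) / ((\<Sum>j\<in>I. w j) - real (card I) * (MIN j\<in>I. w j)))"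
    by (intro sum.cong) (auto simp: residual_def)
  also have "\<dots> = 1"
    using False by (simp add: sum_divide_distrib[symmetric] sum_subtractf)
  finally show ?thesis .
qed

text \<open>
  For \<open>overlap I w < 1\<close> this is the definition of the residual law, rearranged. Otherwise the
  weights sum to \<open>|I|\<close> times their minimum, so they are all equal and the law proportional to \<open>w\<close>
  is itself uniform.
\<close>

lemma overlap_residual_mixture:
  assumes "i \<in> I"
  shows "overlap I w / real (card I) + (1 - overlap I w) * residual I w i
    = w i / (\<Sum>j\<in>I. w j)"
proof -
  define S where "S = (\<Sum>j\<in>I. w j)"
  define m where "m = (MIN j\<in>I. w j)"
  define n where "n = real (card I)"
  have S: "S > 0" using sum_weights_pos by (simp add: S_def)
  have n: "n > 0" using fin ne by (simp add: n_def card_gt_0_iff)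
  have o: "overlap I w = n * m / S" by (simp add: overlap_def S_def m_def n_def field_simps)
  show ?thesis
  proof (cases "S = n * m")
    case True
    have "w i = m"
    proof (rule ccontr)
      assume "w i \<noteq> m"
      then have "m < w i"
        using Min_le[of "w ` I" "w i"] fin assms by (auto simp: m_def less_le)
      then have "(\<Sum>j\<in>I. m) < (\<Sum>j\<in>I. w j)"
        using fin assms by (intro sum_strict_mono_ex1) (auto simp: m_def)
      then show False using True by (simp add: S_def n_def)
    qed
    moreover have "m \<noteq> 0" using True S by auto
    ultimately show ?thesis using True S n o by (simp add: S_def[symmetric] n_def[symmetric])
  next
    case False
    then have "residual I w i = (w i - m) / (S - n * m)"
      using assms by (simp add: residual_def S_def m_def n_def)
    moreover have "1 - n * m / S = (S - n * m) / S" using S by (simp add: field_simps)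
    ultimately show ?thesis using False S n
      by (simp add: o S_def[symmetric] n_def[symmetric] add_divide_distrib[symmetric])
  qed
qed

text \<open>
  Positivity of the weights is what makes the defining function of \<open>multinoulli_pmf\<close> a probability
  mass function, so that the embedding into the type of mass functions returns it unchanged.
\<close>

lemma pmf_multinoulli:
  "pmf (multinoulli_pmf w I) i = (if i \<in> I then w i / (\<Sum>j\<in>I. w j) else 0)"
  unfolding multinoulli_pmf_def
proof (rule pmf_embed_pmf)
  show "0 \<le> (if i \<in> I then w i / (\<Sum>j\<in>I. w j) else 0)" for i
    using pos sum_weights_pos by (auto intro: less_imp_le)
  have "(\<integral>\<^sup>+ i. ennreal (if i \<in> I then w i / (\<Sum>j\<in>I. w j) else 0) \<partial>count_space UNIV)
      = (\<Sum>i\<in>I. ennreal (w i / (\<Sum>j\<in>I. w j)))"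
    by (subst nn_integral_count_space'[of I]) (auto simp: fin)
  also have "\<dots> = ennreal (\<Sum>i\<in>I. w i / (\<Sum>j\<in>I. w j))"
    using pos sum_weights_pos by (intro sum_ennreal) (auto intro: less_imp_le)
  also have "\<dots> = 1"
    using sum_weights_pos by (simp add: sum_divide_distrib[symmetric])
  finally show "(\<integral>\<^sup>+ i. ennreal (if i \<in> I then w i / (\<Sum>j\<in>I. w j) else 0) \<partial>count_space UNIV) = 1" .
qed

end

section \<open>Index orbits\<close>

lemma index_orbits0_subset: "index_orbits0 k \<subseteq> Pow {- (2 ^ k)..2 ^ k}"
  by (auto simp: index_orbits0_def index_orbit_def)

lemma finite_index_orbits0: "finite (index_orbits0 k)"
  by (rule finite_subset[OF index_orbits0_subset]) simp

lemma index_orbits0_nonempty: "index_orbits0 k \<noteq> {}"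
proof -
  have "{0..<0 + 2 ^ k} \<in> index_orbits0 k"
    unfolding index_orbits0_def index_orbit_def by (auto simp del: add_0 simp: nat_power_eq)
  then show ?thesis by blast
qed

lemma index_orbit_finite_nonempty:
  assumes "I \<in> index_orbits0 k"
  shows "finite I" "I \<noteq> {}"
  using assms by (auto simp: index_orbits0_def index_orbit_def)

section \<open>The Gaussian velocity\<close>

text \<open>
  By Tonelli the integral of the density is a product of one-dimensional normal integrals. The
  coordinates are inner products with the basis vectors \<open>axis i 1\<close>, so the product over the index
  type is a product over the basis.
\<close>

lemma prob_space_std_gaussian: "prob_space (std_gaussian :: (real ^ 'd) measure)"
proof
  have B: "(Basis :: (real ^ 'd) set) = (\<lambda>i. axis i 1) ` UNIV"
    by (auto simp: Basis_vec_def)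
  have inj: "inj (\<lambda>i :: 'd. axis i (1::real))"
    by (auto simp: inj_on_def axis_eq_axis)
  have "emeasure std_gaussian (space (std_gaussian :: (real ^ 'd) measure))
      = (\<integral>\<^sup>+ v. ennreal (\<Prod>i\<in>UNIV. std_normal_density (v $ i)) \<partial>(lborel :: (real ^ 'd) measure))"
    unfolding std_gaussian_def by (subst emeasure_density) (auto simp: normal_density_def)
  also have "\<dots> = (\<integral>\<^sup>+ v. (\<Prod>b\<in>Basis. ennreal (std_normal_density (v \<bullet> b)))
      \<partial>(lborel :: (real ^ 'd) measure))"
    unfolding B by (subst prod.reindex[OF inj]) (simp add: prod_ennreal inner_axis)
  also have "\<dots> = (\<Prod>b\<in>(Basis :: (real ^ 'd) set). (\<integral>\<^sup>+ x. ennreal (std_normal_density x) \<partial>lborel))"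
    by (rule nn_integral_lborel_prod) auto
  also have "(\<integral>\<^sup>+ x. ennreal (std_normal_density x) \<partial>lborel) = 1"
    using prob_space.emeasure_space_1[OF prob_space_normal_density[of 1 0]]
    by (simp add: emeasure_density)
  finally show "emeasure std_gaussian (space (std_gaussian :: (real ^ 'd) measure)) = 1"
    by simp
qed

lemma sets_std_gaussian [measurable_cong]: "sets std_gaussian = sets borel"
  by (simp add: std_gaussian_def)

section \<open>Continuity of the leapfrog dynamics\<close>

text \<open>
  The half, full and half step of the leapfrog scheme undone in reverse order. Continuity of the
  inverse can be read off from this formula.
\<close>

definition leapfrog_back ::
  "((real ^ 'd) \<Rightarrow> real) \<Rightarrow> real \<Rightarrow> (real ^ 'd) \<times> (real ^ 'd) \<Rightarrow> (real ^ 'd) \<times> (real ^ 'd)" where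
  "leapfrog_back U h = (\<lambda>(x, v).
     let x' = x - h *\<^sub>R (v + (h / 2) *\<^sub>R grad U x)
     in (x', v + (h / 2) *\<^sub>R grad U x + (h / 2) *\<^sub>R grad U x'))"

lemma inv_leapfrog: "inv (leapfrog U h) = leapfrog_back U h"
  by (rule inv_equality) (auto simp: leapfrog_def leapfrog_back_def Let_def split: prod.splits)

lemma continuous_funpow:
  fixes f :: "'a::topological_space \<Rightarrow> 'a"
  assumes "continuous_on UNIV f"
  shows "continuous_on UNIV (f ^^ n)"
proof (induction n)
  case (Suc n)
  then show ?case
    using continuous_on_compose[OF Suc, of f] continuous_on_subset[OF assms] by simp
qed (simp add: id_def continuous_on_id)

context
  fixes U :: "real ^ 'd \<Rightarrow> real"
  assumes cont_grad: "continuous_on UNIV (grad U)"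
begin

lemma continuous_leapfrog: "continuous_on UNIV (leapfrog U h)"
  unfolding leapfrog_def Let_def case_prod_beta
  by (intro continuous_intros continuous_on_compose2[OF cont_grad]) auto

lemma continuous_leapfrog_back: "continuous_on UNIV (leapfrog_back U h)"
  unfolding leapfrog_back_def Let_def case_prod_beta
  by (intro continuous_intros continuous_on_compose2[OF cont_grad]) auto

text \<open>
  For negative \<open>i\<close> the iterates are those of the explicit inverse, hence continuous as well.
\<close>

lemma continuous_leapfrog_iter: "continuous_on UNIV (leapfrog_iter U h i)"
  unfolding leapfrog_iter_def inv_leapfrog
  using continuous_funpow[OF continuous_leapfrog] continuous_funpow[OF continuous_leapfrog_back]
  by simp

lemma borel_measurable_hmc_output:
  "(\<lambda>v. hmc_output U h x v i) \<in> borel_measurable borel"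
  unfolding hmc_output_def
  by (intro borel_measurable_continuous_onI continuous_intros
      continuous_on_compose2[OF continuous_leapfrog_iter]) auto

lemma borel_measurable_boltzmann_weight:
  assumes "continuous_on UNIV U"
  shows "(\<lambda>v. boltzmann_weight U h x v i) \<in> borel_measurable borel"
  unfolding boltzmann_weight_def hamiltonian_def case_prod_beta
  by (intro borel_measurable_continuous_onI continuous_intros
      continuous_on_compose2[OF assms] continuous_on_compose2[OF continuous_leapfrog_iter]) auto

end

lemma boltzmann_weight_pos: "0 < boltzmann_weight U h x v i"
  by (simp add: boltzmann_weight_def)

section \<open>The coupling through a uniform threshold\<close>

abbreviation unif01 :: "real measure" where
  "unif01 \<equiv> uniform_measure lborel {0..1}"

lemma prob_space_unif01: "prob_space unif01"
  by (rule prob_space_uniform_measure) auto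

text \<open>
  A uniform threshold variable realizes a two-component mixture: this is how \<open>W\<close> chooses between
  the uniform and the residual index.
\<close>

lemma nn_integral_unif01_threshold:
  fixes a b :: ennreal
  assumes "0 \<le> p" "p \<le> 1"
  shows "(\<integral>\<^sup>+ t. (if t \<le> p then a else b) \<partial>unif01) = ennreal p * a + ennreal (1 - p) * b"
proof -
  have *: "emeasure unif01 {..p} = ennreal p" "emeasure unif01 {p<..} = ennreal (1 - p)"
  proof -
    have "{0..1} \<inter> {..p} = {0..p}" "{0..1} \<inter> {p<..} = {p<..1}" using assms by auto
    then show "emeasure unif01 {..p} = ennreal p" "emeasure unif01 {p<..} = ennreal (1 - p)"
      using assms by (simp_all add: emeasure_uniform_measure divide_ennreal[of _ 1, simplified])
  qed
  have "(\<integral>\<^sup>+ t. (if t \<le> p then a else b) \<partial>unif01)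
      = (\<integral>\<^sup>+ t. a * indicator {..p} t + b * indicator {p<..} t \<partial>unif01)"
    by (intro nn_integral_cong) (auto simp: indicator_def)
  also have "\<dots> = a * emeasure unif01 {..p} + b * emeasure unif01 {p<..}"
    by (subst nn_integral_add) (auto simp: nn_integral_cmult)
  finally show ?thesis unfolding * by (simp add: mult.commute)
qed

text \<open>
  The coupling depends on the dynamics only through the positive weights, which are measurable in the
  velocity. The velocity may thus live in any probability space, and the index sets may be any
  finite family of nonempty finite sets. Finiteness turns integrals over the orbit and the indices
  into sums, and lets joint measurability be checked for each orbit and index separately.
\<close>

locale overlap_coupling = prob_space G for G :: "'v measure" +
  fixes J :: "'i set set" and w :: "'v \<Rightarrow> 'i \<Rightarrow> real"
  assumes finite_J: "finite J" and J_nonempty: "J \<noteq> {}"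
    and finite_I: "\<And>I. I \<in> J \<Longrightarrow> finite I" and I_nonempty: "\<And>I. I \<in> J \<Longrightarrow> I \<noteq> {}"
    and w_pos: "\<And>v i. 0 < w v i"
    and w_measurable: "\<And>i. (\<lambda>v. w v i) \<in> borel_measurable G"
begin

definition carrier_space :: "('v \<times> 'i set \<times> real \<times> 'i \<times> 'i) measure" where
  "carrier_space = G \<Otimes>\<^sub>M count_space J \<Otimes>\<^sub>M unif01 \<Otimes>\<^sub>M count_space (\<Union>J) \<Otimes>\<^sub>M count_space (\<Union>J)"

text \<open>
  The entries \<open>i\<close> and \<open>j\<close> are the residual and the uniform index. Both range over \<open>\<Union>J\<close>, and the
  density confines them to \<open>I\<close>. It does not depend on \<open>t\<close>, which makes the uniform variable
  independent of everything else.
\<close>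

definition coupling_density :: "'v \<times> 'i set \<times> real \<times> 'i \<times> 'i \<Rightarrow> ennreal" where
  "coupling_density = (\<lambda>(v, I, t, i, j). ennreal (1 / real (card J)) *
     ennreal (residual I (w v) i * (indicator I j / real (card I))))"

definition coupling :: "('v \<times> 'i set \<times> real \<times> 'i \<times> 'i) measure" where
  "coupling = density carrier_space coupling_density"

text \<open>
  The index is defined by a pointwise rule, rather than by its conditional law given \<open>j\<close>, so that
  it equals the uniform index everywhere on the event and not merely almost surely.
\<close>

definition multinoulli_index :: "'v \<times> 'i set \<times> real \<times> 'i \<times> 'i \<Rightarrow> 'i" where
  "multinoulli_index = (\<lambda>(v, I, t, i, j). if t \<le> overlap I (w v) then j else i)"

definition uniform_index :: "'v \<times> 'i set \<times> real \<times> 'i \<times> 'i \<Rightarrow> 'i" where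
  "uniform_index = (\<lambda>(v, I, t, i, j). j)"

lemma finite_Union_J: "finite (\<Union>J)"
  using finite_J finite_I by auto

lemma sets_coupling [measurable_cong, simp]: "sets coupling = sets carrier_space"
  by (simp add: coupling_def)

lemma space_coupling [simp]: "space coupling = space carrier_space"
  by (simp add: coupling_def)

text \<open>
  The discrete coordinates are needed in two forms: with values in their finite ranges, which allows
  measurability to be checked for each fixed value, and with values in the whole type, as the
  joint laws require.
\<close>

lemma measurable_proj_raw:
  "fst \<in> carrier_space \<rightarrow>\<^sub>M G"
  "(\<lambda>\<omega>. fst (snd \<omega>)) \<in> carrier_space \<rightarrow>\<^sub>M count_space J"
  "(\<lambda>\<omega>. fst (snd (snd \<omega>))) \<in> carrier_space \<rightarrow>\<^sub>M borel"
  "(\<lambda>\<omega>. fst (snd (snd (snd \<omega>)))) \<in> carrier_space \<rightarrow>\<^sub>M count_space (\<Union>J)"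
  "(\<lambda>\<omega>. snd (snd (snd (snd \<omega>)))) \<in> carrier_space \<rightarrow>\<^sub>M count_space (\<Union>J)"
proof -
  show "(\<lambda>\<omega>. fst (snd (snd \<omega>))) \<in> carrier_space \<rightarrow>\<^sub>M borel"
    by (subst measurable_cong_sets[OF refl, of _ unif01])
       (auto simp: carrier_space_def)
qed (auto simp: carrier_space_def)

lemma measurable_proj [measurable]:
  "fst \<in> carrier_space \<rightarrow>\<^sub>M G"
  "(\<lambda>\<omega>. fst (snd \<omega>)) \<in> carrier_space \<rightarrow>\<^sub>M count_space UNIV"
  "(\<lambda>\<omega>. fst (snd (snd \<omega>))) \<in> carrier_space \<rightarrow>\<^sub>M borel"
  "(\<lambda>\<omega>. fst (snd (snd (snd \<omega>)))) \<in> carrier_space \<rightarrow>\<^sub>M count_space UNIV"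
  "(\<lambda>\<omega>. snd (snd (snd (snd \<omega>)))) \<in> carrier_space \<rightarrow>\<^sub>M count_space UNIV"
  using measurable_proj_raw(1,3)
    measurable_compose[OF measurable_proj_raw(2) measurable_count_space]
    measurable_compose[OF measurable_proj_raw(4) measurable_count_space]
    measurable_compose[OF measurable_proj_raw(5) measurable_count_space]
  by auto

lemma measurable_overlap:
  "(\<lambda>\<omega>. overlap (fst (snd \<omega>)) (w (fst \<omega>))) \<in> borel_measurable carrier_space"
proof (rule measurable_compose_countable'[OF _ measurable_proj_raw(2)])
  fix I assume "I \<in> J"
  note [measurable] = finite_I[OF this] measurable_compose[OF measurable_proj(1) w_measurable]
  show "(\<lambda>\<omega>. overlap I (w (fst \<omega>))) \<in> borel_measurable carrier_space"
    unfolding overlap_def by measurable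
qed (simp add: countable_finite finite_J)

lemma pred_overlap_event [measurable]:
  "Measurable.pred carrier_space (\<lambda>\<omega>. fst (snd (snd \<omega>)) \<le> overlap (fst (snd \<omega>)) (w (fst \<omega>)))"
  using measurable_overlap by measurable

lemma measurable_uniform_index [measurable]: "uniform_index \<in> carrier_space \<rightarrow>\<^sub>M count_space UNIV"
  unfolding uniform_index_def case_prod_beta by measurable

lemma measurable_multinoulli_index [measurable]:
  "multinoulli_index \<in> carrier_space \<rightarrow>\<^sub>M count_space UNIV"
  unfolding multinoulli_index_def case_prod_beta by measurable

lemma measurable_coupling_density [measurable]: "coupling_density \<in> borel_measurable carrier_space"
proof -
  have "(\<lambda>\<omega>. residual (fst (snd \<omega>)) (w (fst \<omega>)) (fst (snd (snd (snd \<omega>)))))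
      \<in> borel_measurable carrier_space"
  proof (rule measurable_compose_countable'[OF _ measurable_proj_raw(2)])
    fix I assume "I \<in> J"
    note [measurable] = finite_I[OF this] measurable_compose[OF measurable_proj(1) w_measurable]
    show "(\<lambda>\<omega>. residual I (w (fst \<omega>)) (fst (snd (snd (snd \<omega>))))) \<in> borel_measurable carrier_space"
      by (rule measurable_compose_countable'[OF _ measurable_proj_raw(4)])
         (auto simp: residual_def countable_finite finite_Union_J)
  qed (simp add: countable_finite finite_J)
  note [measurable] = this
  have [measurable]: "(\<lambda>\<omega>. indicator (fst (snd \<omega>)) (snd (snd (snd (snd \<omega>)))) / real (card (fst (snd \<omega>))))
      \<in> borel_measurable carrier_space"
    by (rule measurable_compose_countable'[OF _ measurable_proj_raw(2)])
       (auto intro!: measurable_compose[OF measurable_proj(5)] simp: countable_finite finite_J)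
  show ?thesis unfolding coupling_density_def case_prod_beta by measurable
qed

lemma nn_integral_carrier_space:
  assumes f: "f \<in> borel_measurable carrier_space"
  shows "(\<integral>\<^sup>+ \<omega>. f \<omega> \<partial>carrier_space)
    = (\<integral>\<^sup>+ v. (\<Sum>I\<in>J. \<integral>\<^sup>+ t. (\<Sum>i\<in>\<Union>J. \<Sum>j\<in>\<Union>J. f (v, I, t, i, j)) \<partial>unif01) \<partial>G)"
proof -
  interpret Un: prob_space unif01 by (rule prob_space_unif01)
  interpret cJ: sigma_finite_measure "count_space J"
    by (rule sigma_finite_measure_count_space_finite[OF finite_J])
  interpret cK: sigma_finite_measure "count_space (\<Union>J)"
    by (rule sigma_finite_measure_count_space_finite[OF finite_Union_J])
  interpret KK: pair_sigma_finite "count_space (\<Union>J)" "count_space (\<Union>J)" ..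
  interpret UKK: pair_sigma_finite unif01 "count_space (\<Union>J) \<Otimes>\<^sub>M count_space (\<Union>J)" ..
  interpret JUKK: pair_sigma_finite "count_space J" "unif01 \<Otimes>\<^sub>M count_space (\<Union>J) \<Otimes>\<^sub>M count_space (\<Union>J)" ..
  note f' = f[unfolded carrier_space_def]
  have f1: "(\<lambda>y. f (v, y)) \<in> borel_measurable (count_space J \<Otimes>\<^sub>M unif01 \<Otimes>\<^sub>M count_space (\<Union>J) \<Otimes>\<^sub>M count_space (\<Union>J))"
    if "v \<in> space G" for v
    using measurable_compose[OF measurable_Pair1'[OF that] f'] by simp
  have f2: "(\<lambda>y. f (v, I, y)) \<in> borel_measurable (unif01 \<Otimes>\<^sub>M count_space (\<Union>J) \<Otimes>\<^sub>M count_space (\<Union>J))"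
    if "v \<in> space G" "I \<in> J" for v I
    using measurable_compose[OF measurable_Pair1' f1[OF that(1)], of I] that(2) by simp
  have f3: "(\<lambda>y. f (v, I, t, y)) \<in> borel_measurable (count_space (\<Union>J) \<Otimes>\<^sub>M count_space (\<Union>J))"
    if "v \<in> space G" "I \<in> J" for v I t
    using measurable_compose[OF measurable_Pair1' f2[OF that], of t] by simp
  have "(\<integral>\<^sup>+ \<omega>. f \<omega> \<partial>carrier_space) = (\<integral>\<^sup>+ v. \<integral>\<^sup>+ y. f (v, y)
      \<partial>(count_space J \<Otimes>\<^sub>M unif01 \<Otimes>\<^sub>M count_space (\<Union>J) \<Otimes>\<^sub>M count_space (\<Union>J)) \<partial>G)"
    unfolding carrier_space_def by (rule JUKK.P.nn_integral_fst[OF f', symmetric])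
  also have "\<dots> = (\<integral>\<^sup>+ v. (\<Sum>I\<in>J. \<integral>\<^sup>+ t. (\<Sum>i\<in>\<Union>J. \<Sum>j\<in>\<Union>J. f (v, I, t, i, j)) \<partial>unif01) \<partial>G)"
  proof (rule nn_integral_cong)
    fix v assume v: "v \<in> space G"
    have "(\<integral>\<^sup>+ y. f (v, y) \<partial>(count_space J \<Otimes>\<^sub>M unif01 \<Otimes>\<^sub>M count_space (\<Union>J) \<Otimes>\<^sub>M count_space (\<Union>J)))
      = (\<integral>\<^sup>+ I. \<integral>\<^sup>+ y. f (v, I, y) \<partial>(unif01 \<Otimes>\<^sub>M count_space (\<Union>J) \<Otimes>\<^sub>M count_space (\<Union>J)) \<partial>count_space J)"
      by (rule UKK.P.nn_integral_fst[OF f1[OF v], symmetric])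
    also have "\<dots> = (\<Sum>I\<in>J. \<integral>\<^sup>+ y. f (v, I, y) \<partial>(unif01 \<Otimes>\<^sub>M count_space (\<Union>J) \<Otimes>\<^sub>M count_space (\<Union>J)))"
      by (rule nn_integral_count_space_finite[OF finite_J])
    also have "\<dots> = (\<Sum>I\<in>J. \<integral>\<^sup>+ t. (\<Sum>i\<in>\<Union>J. \<Sum>j\<in>\<Union>J. f (v, I, t, i, j)) \<partial>unif01)"
    proof (rule sum.cong[OF refl])
      fix I assume I: "I \<in> J"
      have "(\<integral>\<^sup>+ y. f (v, I, y) \<partial>(unif01 \<Otimes>\<^sub>M count_space (\<Union>J) \<Otimes>\<^sub>M count_space (\<Union>J)))
          = (\<integral>\<^sup>+ t. \<integral>\<^sup>+ y. f (v, I, t, y) \<partial>(count_space (\<Union>J) \<Otimes>\<^sub>M count_space (\<Union>J)) \<partial>unif01)"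
        by (rule KK.P.nn_integral_fst[OF f2[OF v I], symmetric])
      also have "\<dots> = (\<integral>\<^sup>+ t. (\<Sum>i\<in>\<Union>J. \<Sum>j\<in>\<Union>J. f (v, I, t, i, j)) \<partial>unif01)"
        by (subst cK.nn_integral_fst[OF f3[OF v I], symmetric])
           (simp add: nn_integral_count_space_finite[OF finite_Union_J])
      finally show "(\<integral>\<^sup>+ y. f (v, I, y) \<partial>(unif01 \<Otimes>\<^sub>M count_space (\<Union>J) \<Otimes>\<^sub>M count_space (\<Union>J)))
          = (\<integral>\<^sup>+ t. (\<Sum>i\<in>\<Union>J. \<Sum>j\<in>\<Union>J. f (v, I, t, i, j)) \<partial>unif01)" .
    qed
    finally show "(\<integral>\<^sup>+ y. f (v, y) \<partial>(count_space J \<Otimes>\<^sub>M unif01 \<Otimes>\<^sub>M count_space (\<Union>J) \<Otimes>\<^sub>M count_space (\<Union>J)))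
      = (\<Sum>I\<in>J. \<integral>\<^sup>+ t. (\<Sum>i\<in>\<Union>J. \<Sum>j\<in>\<Union>J. f (v, I, t, i, j)) \<partial>unif01)" .
  qed
  finally show ?thesis .
qed

lemma nn_integral_coupling:
  assumes [measurable]: "f \<in> borel_measurable carrier_space"
  shows "(\<integral>\<^sup>+ \<omega>. f \<omega> \<partial>coupling)
    = (\<integral>\<^sup>+ v. (\<Sum>I\<in>J. ennreal (1 / real (card J)) * (\<integral>\<^sup>+ t. (\<Sum>i\<in>I. \<Sum>j\<in>I.
        ennreal (residual I (w v) i) * ennreal (1 / real (card I)) * f (v, I, t, i, j)) \<partial>unif01)) \<partial>G)"
proof -
  have f_sec: "(\<lambda>t. f (v, I, t, i, j)) \<in> borel_measurable unif01"
    if "v \<in> space G" "I \<in> J" "i \<in> I" "j \<in> I" for v I i j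
  proof -
    have "(\<lambda>t. (v, I, t, i, j)) \<in> unif01 \<rightarrow>\<^sub>M carrier_space"
      unfolding carrier_space_def using that by (intro measurable_Pair measurable_const) auto
    from measurable_compose[OF this assms] show ?thesis .
  qed
  have "(\<integral>\<^sup>+ \<omega>. f \<omega> \<partial>coupling) = (\<integral>\<^sup>+ \<omega>. coupling_density \<omega> * f \<omega> \<partial>carrier_space)"
    unfolding coupling_def by (rule nn_integral_density) auto
  also have "\<dots> = (\<integral>\<^sup>+ v. (\<Sum>I\<in>J. \<integral>\<^sup>+ t. (\<Sum>i\<in>\<Union>J. \<Sum>j\<in>\<Union>J.
      coupling_density (v, I, t, i, j) * f (v, I, t, i, j)) \<partial>unif01) \<partial>G)"
    by (rule nn_integral_carrier_space) auto
  also have "\<dots> = (\<integral>\<^sup>+ v. (\<Sum>I\<in>J. ennreal (1 / real (card J)) * (\<integral>\<^sup>+ t. (\<Sum>i\<in>I. \<Sum>j\<in>I.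
        ennreal (residual I (w v) i) * ennreal (1 / real (card I)) * f (v, I, t, i, j)) \<partial>unif01)) \<partial>G)"
  proof (intro nn_integral_cong sum.cong refl)
    fix v I assume v: "v \<in> space G" and I: "I \<in> J"
    have "(\<Sum>i\<in>\<Union>J. \<Sum>j\<in>\<Union>J. coupling_density (v, I, t, i, j) * f (v, I, t, i, j))
      = ennreal (1 / real (card J)) * (\<Sum>i\<in>I. \<Sum>j\<in>I.
        ennreal (residual I (w v) i) * ennreal (1 / real (card I)) * f (v, I, t, i, j))" for t
    proof -
      have "(\<Sum>i\<in>\<Union>J. \<Sum>j\<in>\<Union>J. coupling_density (v, I, t, i, j) * f (v, I, t, i, j))
        = (\<Sum>i\<in>I. \<Sum>j\<in>\<Union>J. coupling_density (v, I, t, i, j) * f (v, I, t, i, j))"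
        using I by (intro sum.mono_neutral_right finite_Union_J)
          (auto simp: coupling_density_def residual_def)
      also have "\<dots> = (\<Sum>i\<in>I. \<Sum>j\<in>I. coupling_density (v, I, t, i, j) * f (v, I, t, i, j))"
        using I by (intro sum.cong refl sum.mono_neutral_right finite_Union_J)
          (auto simp: coupling_density_def)
      also have "\<dots> = (\<Sum>i\<in>I. \<Sum>j\<in>I. ennreal (1 / real (card J)) *
          (ennreal (residual I (w v) i) * ennreal (1 / real (card I)) * f (v, I, t, i, j)))"
        by (intro sum.cong refl)
          (simp add: coupling_density_def ennreal_mult''[symmetric] mult.assoc[symmetric])
      finally show ?thesis by (simp add: sum_distrib_left)
    qed
    then show "(\<integral>\<^sup>+ t. (\<Sum>i\<in>\<Union>J. \<Sum>j\<in>\<Union>J. coupling_density (v, I, t, i, j) * f (v, I, t, i, j)) \<partial>unif01)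
      = ennreal (1 / real (card J)) * (\<integral>\<^sup>+ t. (\<Sum>i\<in>I. \<Sum>j\<in>I.
        ennreal (residual I (w v) i) * ennreal (1 / real (card I)) * f (v, I, t, i, j)) \<partial>unif01)"
      by (simp only:) (intro nn_integral_cmult borel_measurable_sum borel_measurable_times_ennreal
          borel_measurable_const f_sec[OF v I])
  qed
  finally show ?thesis .
qed

lemma sum_ennreal_residual: "I \<in> J \<Longrightarrow> (\<Sum>i\<in>I. ennreal (residual I (w v) i)) = 1"
  using finite_I I_nonempty w_pos
  by (subst sum_ennreal) (auto simp: sum_residual intro!: residual_nonneg)

lemma sum_ennreal_uniform: "I \<in> J \<Longrightarrow> (\<Sum>i\<in>I. ennreal (1 / real (card I))) = 1"
  using finite_I[of I] I_nonempty[of I]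
  by (subst sum_ennreal) auto

text \<open>
  The masses of the residual and of the uniform index each sum to one, so both indices integrate out.
\<close>

lemma nn_integral_coupling_base:
  assumes f: "(\<lambda>\<omega>. f (fst \<omega>) (fst (snd \<omega>)) (fst (snd (snd \<omega>)))) \<in> borel_measurable carrier_space"
  shows "(\<integral>\<^sup>+ \<omega>. f (fst \<omega>) (fst (snd \<omega>)) (fst (snd (snd \<omega>))) \<partial>coupling)
    = (\<integral>\<^sup>+ v. (\<Sum>I\<in>J. ennreal (1 / real (card J)) * (\<integral>\<^sup>+ t. f v I t \<partial>unif01)) \<partial>G)"
  unfolding nn_integral_coupling[OF f]
proof (intro nn_integral_cong sum.cong refl arg_cong2[where f="(*)"])
  fix v I t assume "I \<in> J"
  have "(\<Sum>i\<in>I. \<Sum>j\<in>I. ennreal (residual I (w v) i) * ennreal (1 / real (card I)) * f v I t)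
    = (\<Sum>i\<in>I. ennreal (residual I (w v) i)) * (\<Sum>j\<in>I. ennreal (1 / real (card I))) * f v I t"
    unfolding sum_product by (simp only: sum_distrib_right)
  then show "(\<Sum>i\<in>I. \<Sum>j\<in>I. ennreal (residual I (w v) i) * ennreal (1 / real (card I)) *
      f (fst (v, I, t, i, j)) (fst (snd (v, I, t, i, j))) (fst (snd (snd (v, I, t, i, j))))) = f v I t"
    using \<open>I \<in> J\<close> by (simp only: fst_conv snd_conv sum_ennreal_residual sum_ennreal_uniform mult_1)
qed

lemma nn_integral_coupling_uniform:
  assumes f: "(\<lambda>\<omega>. f (fst \<omega>) (fst (snd \<omega>)) (uniform_index \<omega>)) \<in> borel_measurable carrier_space"
  shows "(\<integral>\<^sup>+ \<omega>. f (fst \<omega>) (fst (snd \<omega>)) (uniform_index \<omega>) \<partial>coupling)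
    = (\<integral>\<^sup>+ v. (\<Sum>I\<in>J. ennreal (1 / real (card J)) * (\<Sum>j\<in>I. ennreal (1 / real (card I)) * f v I j)) \<partial>G)"
  unfolding nn_integral_coupling[OF f]
proof (intro nn_integral_cong sum.cong refl arg_cong2[where f="(*)"])
  fix v I assume "I \<in> J"
  interpret Un: prob_space unif01 by (rule prob_space_unif01)
  have "(\<Sum>i\<in>I. \<Sum>j\<in>I. ennreal (residual I (w v) i) * ennreal (1 / real (card I)) * f v I j)
    = (\<Sum>i\<in>I. ennreal (residual I (w v) i)) * (\<Sum>j\<in>I. ennreal (1 / real (card I)) * f v I j)"
    unfolding sum_product by (simp only: mult.assoc)
  then show "(\<integral>\<^sup>+ t. (\<Sum>i\<in>I. \<Sum>j\<in>I. ennreal (residual I (w v) i) * ennreal (1 / real (card I)) *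
      f (fst (v, I, t, i, j)) (fst (snd (v, I, t, i, j))) (uniform_index (v, I, t, i, j))) \<partial>unif01)
      = (\<Sum>j\<in>I. ennreal (1 / real (card I)) * f v I j)"
    using \<open>I \<in> J\<close>
    by (simp only: fst_conv snd_conv uniform_index_def prod.case sum_ennreal_residual mult_1
        nn_integral_const Un.emeasure_space_1 mult_1_right)
qed

text \<open>
  Integrating \<open>t\<close> first leaves the mixture of the uniform and the residual law with weights
  \<open>p\<close> and \<open>1 - p\<close>, \<open>p\<close> being the overlap; by \<open>overlap_residual_mixture\<close> this is the law proportional to
  the weights.
\<close>

lemma nn_integral_coupling_multinoulli:
  assumes f: "(\<lambda>\<omega>. f (fst \<omega>) (fst (snd \<omega>)) (multinoulli_index \<omega>)) \<in> borel_measurable carrier_space"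
  shows "(\<integral>\<^sup>+ \<omega>. f (fst \<omega>) (fst (snd \<omega>)) (multinoulli_index \<omega>) \<partial>coupling)
    = (\<integral>\<^sup>+ v. (\<Sum>I\<in>J. ennreal (1 / real (card J)) *
        (\<Sum>i\<in>I. ennreal (w v i / (\<Sum>j\<in>I. w v j)) * f v I i)) \<partial>G)"
  unfolding nn_integral_coupling[OF f]
proof (intro nn_integral_cong sum.cong refl arg_cong2[where f="(*)"])
  fix v I assume I: "I \<in> J"
  let ?p = "overlap I (w v)" and ?r = "residual I (w v)" and ?n = "real (card I)"
  let ?\<phi> = "f v I"
  have wI: "\<And>i. i \<in> I \<Longrightarrow> 0 < w v i" using w_pos by simp
  note fw = finite_I[OF I] I_nonempty[OF I] wI
  \<comment> \<open>On either side of the threshold one of the two indices is irrelevant and sums to one.\<close>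
  have sums: "(\<Sum>i\<in>I. \<Sum>j\<in>I. ennreal (?r i) * ennreal (1 / ?n) * ?\<phi> (if t \<le> ?p then j else i))
    = (if t \<le> ?p then (\<Sum>j\<in>I. ennreal (1 / ?n) * ?\<phi> j) else (\<Sum>i\<in>I. ennreal (?r i) * ?\<phi> i))" for t
  proof (cases "t \<le> ?p")
    case True
    have "(\<Sum>i\<in>I. \<Sum>j\<in>I. ennreal (?r i) * ennreal (1 / ?n) * ?\<phi> j)
      = (\<Sum>i\<in>I. ennreal (?r i)) * (\<Sum>j\<in>I. ennreal (1 / ?n) * ?\<phi> j)"
      unfolding sum_product by (simp only: mult.assoc)
    then show ?thesis using True I by (simp only: sum_ennreal_residual mult_1 if_True)
  next
    case False
    have "(\<Sum>i\<in>I. \<Sum>j\<in>I. ennreal (?r i) * ennreal (1 / ?n) * ?\<phi> i)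
      = (\<Sum>i\<in>I. ennreal (?r i) * ?\<phi> i) * (\<Sum>j\<in>I. ennreal (1 / ?n))"
      unfolding sum_product by (simp only: mult.assoc mult.commute[of "ennreal (1 / ?n)"])
    then show ?thesis using False I by (simp only: sum_ennreal_uniform mult_1_right if_False)
  qed
  have "(\<integral>\<^sup>+ t. (\<Sum>i\<in>I. \<Sum>j\<in>I. ennreal (?r i) * ennreal (1 / ?n) * ?\<phi> (if t \<le> ?p then j else i)) \<partial>unif01)
    = ennreal ?p * (\<Sum>j\<in>I. ennreal (1 / ?n) * ?\<phi> j) + ennreal (1 - ?p) * (\<Sum>i\<in>I. ennreal (?r i) * ?\<phi> i)"
    unfolding sums
    by (rule nn_integral_unif01_threshold[OF overlap_nonneg[OF fw] overlap_le_1[OF fw]])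
  also have "\<dots> = (\<Sum>i\<in>I. (ennreal ?p * ennreal (1 / ?n) + ennreal (1 - ?p) * ennreal (?r i)) * ?\<phi> i)"
    by (simp only: sum_distrib_left sum.distrib distrib_right mult.assoc)
  also have "\<dots> = (\<Sum>i\<in>I. ennreal (w v i / (\<Sum>j\<in>I. w v j)) * ?\<phi> i)"
  proof (intro sum.cong refl arg_cong2[where f="(*)"])
    fix i assume i: "i \<in> I"
    have "ennreal ?p * ennreal (1 / ?n) + ennreal (1 - ?p) * ennreal (?r i)
      = ennreal (?p / ?n + (1 - ?p) * ?r i)"
      using overlap_nonneg[OF fw] overlap_le_1[OF fw] residual_nonneg[OF fw]
      by (simp add: ennreal_plus[symmetric] ennreal_mult[symmetric] del: ennreal_plus)
    also have "\<dots> = ennreal (w v i / (\<Sum>j\<in>I. w v j))"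
      by (simp only: overlap_residual_mixture[OF fw i])
    finally show "ennreal ?p * ennreal (1 / ?n) + ennreal (1 - ?p) * ennreal (?r i)
      = ennreal (w v i / (\<Sum>j\<in>I. w v j))" .
  qed
  finally show "(\<integral>\<^sup>+ t. (\<Sum>i\<in>I. \<Sum>j\<in>I. ennreal (residual I (w v) i) * ennreal (1 / real (card I)) *
      f (fst (v, I, t, i, j)) (fst (snd (v, I, t, i, j))) (multinoulli_index (v, I, t, i, j))) \<partial>unif01)
      = (\<Sum>i\<in>I. ennreal (w v i / (\<Sum>j\<in>I. w v j)) * f v I i)"
    by (simp only: fst_conv snd_conv multinoulli_index_def prod.case)
qed

lemma prob_space_coupling: "prob_space coupling"
proof
  interpret Un: prob_space unif01 by (rule prob_space_unif01)
  have "emeasure coupling (space coupling) = (\<integral>\<^sup>+ \<omega>. 1 \<partial>coupling)"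
    by simp
  also have "\<dots> = (\<integral>\<^sup>+ v. (\<Sum>I\<in>J. ennreal (1 / real (card J)) * (\<integral>\<^sup>+ t. 1 \<partial>unif01)) \<partial>G)"
    by (rule nn_integral_coupling_base[of "\<lambda>_ _ _. 1"]) simp
  also have "\<dots> = (\<integral>\<^sup>+ v. (\<Sum>I\<in>J. ennreal (1 / real (card J))) \<partial>G)"
    by (simp add: Un.emeasure_space_1)
  also have "(\<Sum>I\<in>J. ennreal (1 / real (card J))) = 1"
    using finite_J J_nonempty by (subst sum_ennreal) auto
  finally show "emeasure coupling (space coupling) = 1"
    by (simp add: emeasure_space_1)
qed

end

section \<open>The laws of the two algorithms\<close>

abbreviation draw_space :: "((real ^ 'd) \<times> int set \<times> int) measure" where
  "draw_space \<equiv> borel \<Otimes>\<^sub>M count_space UNIV \<Otimes>\<^sub>M count_space UNIV"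

lemma emeasure_distr_eq_nn_integral:
  assumes "X \<in> M \<rightarrow>\<^sub>M N" "A \<in> sets N"
  shows "emeasure (distr M N X) A = (\<integral>\<^sup>+ \<omega>. indicator A (X \<omega>) \<partial>M)"
proof -
  have "emeasure (distr M N X) A = (\<integral>\<^sup>+ y. indicator A y \<partial>distr M N X)"
    using assms(2) by simp
  also have "\<dots> = (\<integral>\<^sup>+ \<omega>. indicator A (X \<omega>) \<partial>M)"
    using assms by (intro nn_integral_distr) auto
  finally show ?thesis .
qed

text \<open>
  Evaluating the monadic bind requires the conditional law of \<open>(v, I, L)\<close> given \<open>v\<close> to be a measurable
  kernel. It is, because it is a finite combination of point masses whose coefficients are
  measurable in \<open>v\<close>; the support condition makes the combination finite.
\<close>

lemma
  fixes sel :: "real ^ 'd \<Rightarrow> int set \<Rightarrow> int pmf"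
  assumes sel_measurable: "\<And>I i. I \<in> index_orbits0 k \<Longrightarrow> (\<lambda>v. pmf (sel v I) i) \<in> borel_measurable borel"
    and sel_support: "\<And>v I. I \<in> index_orbits0 k \<Longrightarrow> set_pmf (sel v I) \<subseteq> I"
  shows sets_hmc_draw: "sets (hmc_draw sel k) = sets draw_space"
    and emeasure_hmc_draw: "A \<in> sets draw_space \<Longrightarrow> emeasure (hmc_draw sel k) A =
      (\<integral>\<^sup>+ v. (\<Sum>I\<in>index_orbits0 k. ennreal (1 / real (card (index_orbits0 k))) *
        (\<Sum>i\<in>I. ennreal (pmf (sel v I) i) * indicator A (v, I, i))) \<partial>std_gaussian)"
proof -
  let ?J = "index_orbits0 k"
  define Q where "Q v = bind_pmf (pmf_of_set ?J) (\<lambda>I. map_pmf (\<lambda>L. (I, L)) (sel v I))" for v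
  define K where "K v = distr (measure_pmf (Q v)) draw_space (\<lambda>(I, L). (v, I, L))" for v
  have tuple [measurable]: "(\<lambda>(I, L). (v, I, L)) \<in> measure_pmf (Q v) \<rightarrow>\<^sub>M draw_space" for v :: "real ^ 'd"
    by (simp add: space_pair_measure)
  have point: "(\<lambda>v :: real ^ 'd. (v, I, i)) \<in> borel \<rightarrow>\<^sub>M draw_space" for I :: "int set" and i :: int
    by measurable
  have K: "emeasure (K v) A = (\<Sum>I\<in>?J. ennreal (1 / real (card ?J)) *
        (\<Sum>i\<in>I. ennreal (pmf (sel v I) i) * indicator A (v, I, i)))"
    if A: "A \<in> sets draw_space" for v A
  proof -
    have "emeasure (K v) A
        = (\<integral>\<^sup>+ y. indicator A (case y of (I, L) \<Rightarrow> (v, I, L)) \<partial>measure_pmf (Q v))"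
      unfolding K_def by (rule emeasure_distr_eq_nn_integral[OF tuple A])
    also have "\<dots> = (\<integral>\<^sup>+ I. \<integral>\<^sup>+ i. indicator A (v, I, i) \<partial>measure_pmf (sel v I) \<partial>measure_pmf (pmf_of_set ?J))"
      by (simp add: Q_def)
    also have "\<dots> = (\<Sum>I\<in>?J. (\<integral>\<^sup>+ i. indicator A (v, I, i) \<partial>measure_pmf (sel v I)) * ennreal (pmf (pmf_of_set ?J) I))"
      by (rule nn_integral_measure_pmf_support)
         (auto simp: finite_index_orbits0 index_orbits0_nonempty)
    also have "\<dots> = (\<Sum>I\<in>?J. ennreal (1 / real (card ?J)) *
        (\<Sum>i\<in>I. ennreal (pmf (sel v I) i) * indicator A (v, I, i)))"
    proof (intro sum.cong refl)
      fix I assume I: "I \<in> ?J"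
      have "(\<integral>\<^sup>+ i. indicator A (v, I, i) \<partial>measure_pmf (sel v I))
          = (\<Sum>i\<in>I. indicator A (v, I, i) * ennreal (pmf (sel v I) i))"
        by (rule nn_integral_measure_pmf_support)
           (use I sel_support index_orbit_finite_nonempty in auto)
      then show "(\<integral>\<^sup>+ i. indicator A (v, I, i) \<partial>measure_pmf (sel v I)) * ennreal (pmf (pmf_of_set ?J) I)
        = ennreal (1 / real (card ?J)) * (\<Sum>i\<in>I. ennreal (pmf (sel v I) i) * indicator A (v, I, i))"
        using I by (simp add: finite_index_orbits0 index_orbits0_nonempty mult.commute)
    qed
    finally show ?thesis .
  qed
  have kernel: "K \<in> std_gaussian \<rightarrow>\<^sub>M subprob_algebra draw_space"
  proof (rule measurable_subprob_algebra)
    show "subprob_space (K v)" for v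
      unfolding K_def by (intro prob_space_imp_subprob_space measure_pmf.prob_space_distr tuple)
    show "sets (K v) = sets draw_space" for v by (simp add: K_def)
    fix A assume A: "A \<in> sets (draw_space :: ((real ^ 'd) \<times> int set \<times> int) measure)"
    have [measurable]: "(\<lambda>v. indicator A (v, I, i) :: ennreal) \<in> borel_measurable borel" for I i
      by (rule measurable_compose[OF point borel_measurable_indicator[OF A]])
    show "(\<lambda>v. emeasure (K v) A) \<in> borel_measurable std_gaussian"
      unfolding K[OF A] measurable_cong_sets[OF sets_std_gaussian refl]
      using sel_measurable
      by (intro borel_measurable_sum borel_measurable_times_ennreal borel_measurable_const)
         (auto intro: measurable_compose[OF _ measurable_ennreal])
  qed
  have draw: "hmc_draw sel k = std_gaussian \<bind> K"
    by (simp add: hmc_draw_def K_def[abs_def] Q_def)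
  have ne: "space std_gaussian \<noteq> {}" by (simp add: std_gaussian_def)
  show "sets (hmc_draw sel k) = sets draw_space"
    unfolding draw by (rule sets_bind[OF _ ne]) (simp add: K_def)
  show "emeasure (hmc_draw sel k) A =
      (\<integral>\<^sup>+ v. (\<Sum>I\<in>?J. ennreal (1 / real (card ?J)) *
        (\<Sum>i\<in>I. ennreal (pmf (sel v I) i) * indicator A (v, I, i))) \<partial>std_gaussian)"
    if "A \<in> sets draw_space"
    unfolding draw emeasure_bind[OF ne kernel that] K[OF that] ..
qed

text \<open>
  The output is continuous in the velocity for each of the countably many indices.
\<close>

lemma measurable_hmc_output_draw:
  assumes "continuous_on UNIV (grad U)"
  shows "(\<lambda>(v, I, L). hmc_output U h x v L) \<in> draw_space \<rightarrow>\<^sub>M borel"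
proof -
  have "(\<lambda>\<omega>. hmc_output U h x (fst \<omega>) (snd (snd \<omega>))) \<in> draw_space \<rightarrow>\<^sub>M borel"
    by (rule measurable_compose_countable'[where I=UNIV])
       (auto intro!: measurable_compose[OF measurable_fst borel_measurable_hmc_output[OF assms]])
  then show ?thesis by (simp add: case_prod_beta')
qed

text \<open>
  A transition kernel is the image of the law of \<open>(v, I, L)\<close> under the output map; variables with that
  joint law on any space therefore have an output distributed according to the kernel.
\<close>

lemma hmc_output_realizes_law:
  assumes grad: "continuous_on UNIV (grad U)"
    and X: "(\<lambda>\<omega>. (V \<omega>, I \<omega>, L \<omega>)) \<in> M \<rightarrow>\<^sub>M draw_space"
    and D: "distr M draw_space (\<lambda>\<omega>. (V \<omega>, I \<omega>, L \<omega>)) = D"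
    and P: "P = distr D borel (\<lambda>(v, I, L). hmc_output U h x v L)"
  shows "(\<lambda>\<omega>. hmc_output U h x (V \<omega>) (L \<omega>)) \<in> M \<rightarrow>\<^sub>M P"
    and "distr M P (\<lambda>\<omega>. hmc_output U h x (V \<omega>) (L \<omega>)) = P"
proof -
  note out = measurable_hmc_output_draw[OF grad, of h x]
  have sP: "sets P = sets borel" by (simp add: P)
  show "(\<lambda>\<omega>. hmc_output U h x (V \<omega>) (L \<omega>)) \<in> M \<rightarrow>\<^sub>M P"
    unfolding measurable_cong_sets[OF refl sP] using measurable_compose[OF X out] by simp
  have "distr M P (\<lambda>\<omega>. hmc_output U h x (V \<omega>) (L \<omega>))
      = distr M borel (\<lambda>\<omega>. hmc_output U h x (V \<omega>) (L \<omega>))"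
    by (rule distr_cong) (simp_all add: sP)
  also have "\<dots> = distr (distr M draw_space (\<lambda>\<omega>. (V \<omega>, I \<omega>, L \<omega>))) borel
      (\<lambda>(v, I, L). hmc_output U h x v L)"
    by (subst distr_distr[OF out X]) (simp add: comp_def)
  finally show "distr M P (\<lambda>\<omega>. hmc_output U h x (V \<omega>) (L \<omega>)) = P"
    unfolding D P .
qed

lemma emeasure_gaussian_orbit_unif:
  fixes A :: "((real ^ 'd) \<times> int set \<times> real) set"
  assumes A: "A \<in> sets (borel \<Otimes>\<^sub>M count_space UNIV \<Otimes>\<^sub>M borel)"
  shows "emeasure (std_gaussian \<Otimes>\<^sub>M measure_pmf (pmf_of_set (index_orbits0 k)) \<Otimes>\<^sub>M unif01) A
    = (\<integral>\<^sup>+ v. (\<Sum>I\<in>index_orbits0 k. ennreal (1 / real (card (index_orbits0 k))) *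
        (\<integral>\<^sup>+ t. indicator A (v, I, t) \<partial>unif01)) \<partial>std_gaussian)"
proof -
  let ?J = "index_orbits0 k" and ?N = "measure_pmf (pmf_of_set (index_orbits0 k))"
  interpret Un: prob_space unif01 by (rule prob_space_unif01)
  interpret JU: pair_prob_space ?N unif01 ..
  have s1: "sets (?N \<Otimes>\<^sub>M unif01) = sets (count_space UNIV \<Otimes>\<^sub>M borel)"
    by (rule sets_pair_measure_cong) auto
  have s: "sets (std_gaussian \<Otimes>\<^sub>M ?N \<Otimes>\<^sub>M unif01) = sets (borel \<Otimes>\<^sub>M count_space UNIV \<Otimes>\<^sub>M borel)"
    by (rule sets_pair_measure_cong[OF sets_std_gaussian s1])
  have A': "A \<in> sets (std_gaussian \<Otimes>\<^sub>M ?N \<Otimes>\<^sub>M unif01)" using A s by simp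
  have "emeasure (std_gaussian \<Otimes>\<^sub>M ?N \<Otimes>\<^sub>M unif01) A
      = (\<integral>\<^sup>+ v. \<integral>\<^sup>+ y. indicator A (v, y) \<partial>(?N \<Otimes>\<^sub>M unif01) \<partial>std_gaussian)"
    by (rule JU.P.emeasure_pair_measure[OF A'])
  also have "\<dots> = (\<integral>\<^sup>+ v. (\<Sum>I\<in>?J. ennreal (1 / real (card ?J)) *
        (\<integral>\<^sup>+ t. indicator A (v, I, t) \<partial>unif01)) \<partial>std_gaussian)"
  proof (rule nn_integral_cong)
    fix v :: "real ^ 'd" assume v: "v \<in> space std_gaussian"
    have "(\<lambda>y. indicator A (v, y) :: ennreal) \<in> borel_measurable (?N \<Otimes>\<^sub>M unif01)"
      using measurable_compose[OF measurable_Pair1'[OF v] borel_measurable_indicator[OF A']] by simp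
    from Un.nn_integral_fst[OF this]
    have "(\<integral>\<^sup>+ y. indicator A (v, y) \<partial>(?N \<Otimes>\<^sub>M unif01))
        = (\<integral>\<^sup>+ I. \<integral>\<^sup>+ t. indicator A (v, I, t) \<partial>unif01 \<partial>?N)" by simp
    also have "\<dots> = (\<Sum>I\<in>?J. (\<integral>\<^sup>+ t. indicator A (v, I, t) \<partial>unif01) * ennreal (pmf (pmf_of_set ?J) I))"
      by (rule nn_integral_measure_pmf_support)
         (auto simp: finite_index_orbits0 index_orbits0_nonempty)
    also have "\<dots> = (\<Sum>I\<in>?J. ennreal (1 / real (card ?J)) * (\<integral>\<^sup>+ t. indicator A (v, I, t) \<partial>unif01))"
      by (intro sum.cong refl) (simp add: finite_index_orbits0 index_orbits0_nonempty mult.commute)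
    finally show "(\<integral>\<^sup>+ y. indicator A (v, y) \<partial>(?N \<Otimes>\<^sub>M unif01))
        = (\<Sum>I\<in>?J. ennreal (1 / real (card ?J)) * (\<integral>\<^sup>+ t. indicator A (v, I, t) \<partial>unif01))" .
  qed
  finally show ?thesis .
qed

section \<open>Multinoulli and uniform HMC agree on the index event\<close>

theorem lemma4:
  fixes U :: "real ^ 'd \<Rightarrow> real" and h :: real and k :: nat and x :: "real ^ 'd"
  assumes "\<And>y. U differentiable (at y)"
    and "continuous_on UNIV (grad U)"
    and "integrable lborel (\<lambda>y. exp (- U y))"
    and "h > 0"
  shows "\<exists>(M :: ((real ^ 'd) \<times> int set \<times> real \<times> int \<times> int) measure) V I W L L'.
    prob_space M \<and>
    V \<in> borel_measurable M \<and> I \<in> measurable M (count_space UNIV) \<and> W \<in> borel_measurable M \<and>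
    L \<in> measurable M (count_space UNIV) \<and> L' \<in> measurable M (count_space UNIV) \<and>
    distr M (borel \<Otimes>\<^sub>M count_space UNIV \<Otimes>\<^sub>M borel) (\<lambda>\<omega>. (V \<omega>, I \<omega>, W \<omega>))
      = std_gaussian \<Otimes>\<^sub>M measure_pmf (pmf_of_set (index_orbits0 k)) \<Otimes>\<^sub>M uniform_measure lborel {0..1} \<and>
    distr M (borel \<Otimes>\<^sub>M count_space UNIV \<Otimes>\<^sub>M count_space UNIV) (\<lambda>\<omega>. (V \<omega>, I \<omega>, L \<omega>))
      = mult_hmc_draw U h k x \<and>
    distr M (borel \<Otimes>\<^sub>M count_space UNIV \<Otimes>\<^sub>M count_space UNIV) (\<lambda>\<omega>. (V \<omega>, I \<omega>, L' \<omega>))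
      = unif_hmc_draw k \<and>
    agree_on M {\<omega> \<in> space M. W \<omega> \<le> index_threshold U h x (V \<omega>) (I \<omega>)}
      (mult_hmc U h k x) (\<lambda>\<omega>. hmc_output U h x (V \<omega>) (L \<omega>))
      (unif_hmc U h k x) (\<lambda>\<omega>. hmc_output U h x (V \<omega>) (L' \<omega>))"
proof -
  let ?J = "index_orbits0 k" and ?w = "boltzmann_weight U h x"
  have contU: "continuous_on UNIV U"
    using assms(1) by (auto intro: continuous_at_imp_continuous_on differentiable_imp_continuous_within)
  note w_borel = borel_measurable_boltzmann_weight[OF assms(2) contU, of h x]
  interpret G: prob_space "std_gaussian :: (real ^ 'd) measure" by (rule prob_space_std_gaussian)
  interpret overlap_coupling "std_gaussian :: (real ^ 'd) measure" ?J ?w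
    by standard (use finite_index_orbits0 index_orbits0_nonempty index_orbit_finite_nonempty[of _ k]
        boltzmann_weight_pos w_borel in \<open>auto simp: measurable_cong_sets[OF sets_std_gaussian refl]\<close>)
  define V where "V = (fst :: (real ^ 'd) \<times> int set \<times> real \<times> int \<times> int \<Rightarrow> _)"
  define I where "I = (\<lambda>\<omega> :: (real ^ 'd) \<times> int set \<times> real \<times> int \<times> int. fst (snd \<omega>))"
  define W where "W = (\<lambda>\<omega> :: (real ^ 'd) \<times> int set \<times> real \<times> int \<times> int. fst (snd (snd \<omega>)))"
  have V [measurable]: "V \<in> coupling \<rightarrow>\<^sub>M borel"
    using measurable_proj(1) unfolding V_def measurable_cong_sets[OF sets_coupling sets_std_gaussian]
      measurable_cong_sets[OF refl sets_std_gaussian] measurable_cong_sets[OF sets_coupling refl] .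
  have I [measurable]: "I \<in> coupling \<rightarrow>\<^sub>M count_space UNIV"
    using measurable_proj(2) unfolding I_def measurable_cong_sets[OF sets_coupling refl] .
  have W [measurable]: "W \<in> coupling \<rightarrow>\<^sub>M borel"
    using measurable_proj(3) unfolding W_def measurable_cong_sets[OF sets_coupling refl] .
  have L [measurable]: "multinoulli_index \<in> coupling \<rightarrow>\<^sub>M count_space UNIV"
    and L' [measurable]: "uniform_index \<in> coupling \<rightarrow>\<^sub>M count_space UNIV"
    using measurable_multinoulli_index measurable_uniform_index
    unfolding measurable_cong_sets[OF sets_coupling refl] .
  have VIW: "(\<lambda>\<omega>. (V \<omega>, I \<omega>, W \<omega>)) \<in> coupling \<rightarrow>\<^sub>M borel \<Otimes>\<^sub>M count_space UNIV \<Otimes>\<^sub>M borel"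
    by measurable
  have VIL: "(\<lambda>\<omega>. (V \<omega>, I \<omega>, multinoulli_index \<omega>)) \<in> coupling \<rightarrow>\<^sub>M draw_space"
    by measurable
  have VIL': "(\<lambda>\<omega>. (V \<omega>, I \<omega>, uniform_index \<omega>)) \<in> coupling \<rightarrow>\<^sub>M draw_space"
    by measurable
  note meas_ind = measurable_compose[OF _ borel_measurable_indicator]

  \<comment> \<open>Each of the three laws is identified by evaluating both sides on a measurable set.\<close>
  have law_VIW: "distr coupling (borel \<Otimes>\<^sub>M count_space UNIV \<Otimes>\<^sub>M borel) (\<lambda>\<omega>. (V \<omega>, I \<omega>, W \<omega>))
      = std_gaussian \<Otimes>\<^sub>M measure_pmf (pmf_of_set ?J) \<Otimes>\<^sub>M unif01"
  proof (rule measure_eqI)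
    show "sets (distr coupling (borel \<Otimes>\<^sub>M count_space UNIV \<Otimes>\<^sub>M borel) (\<lambda>\<omega>. (V \<omega>, I \<omega>, W \<omega>)))
      = sets (std_gaussian \<Otimes>\<^sub>M measure_pmf (pmf_of_set ?J) \<Otimes>\<^sub>M unif01)"
      unfolding sets_distr by (intro sets_pair_measure_cong) (auto simp: sets_std_gaussian)
    fix A assume "A \<in> sets (distr coupling (borel \<Otimes>\<^sub>M count_space UNIV \<Otimes>\<^sub>M borel) (\<lambda>\<omega>. (V \<omega>, I \<omega>, W \<omega>)))"
    then have A: "A \<in> sets (borel \<Otimes>\<^sub>M count_space UNIV \<Otimes>\<^sub>M borel)" by simp
    have "emeasure (distr coupling (borel \<Otimes>\<^sub>M count_space UNIV \<Otimes>\<^sub>M borel) (\<lambda>\<omega>. (V \<omega>, I \<omega>, W \<omega>))) A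
      = (\<integral>\<^sup>+ \<omega>. indicator A (V \<omega>, I \<omega>, W \<omega>) \<partial>coupling)"
      by (rule emeasure_distr_eq_nn_integral[OF VIW A])
    also have "\<dots> = (\<integral>\<^sup>+ v. (\<Sum>I\<in>?J. ennreal (1 / real (card ?J)) *
        (\<integral>\<^sup>+ t. indicator A (v, I, t) \<partial>unif01)) \<partial>std_gaussian)"
      using nn_integral_coupling_base[of "\<lambda>v I t. indicator A (v, I, t)"] meas_ind[OF VIW A]
      unfolding V_def I_def W_def measurable_cong_sets[OF sets_coupling refl] by blast
    also have "\<dots> = emeasure (std_gaussian \<Otimes>\<^sub>M measure_pmf (pmf_of_set ?J) \<Otimes>\<^sub>M unif01) A"
      by (rule emeasure_gaussian_orbit_unif[OF A, symmetric])
    finally show "emeasure (distr coupling (borel \<Otimes>\<^sub>M count_space UNIV \<Otimes>\<^sub>M borel) (\<lambda>\<omega>. (V \<omega>, I \<omega>, W \<omega>))) A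
      = emeasure (std_gaussian \<Otimes>\<^sub>M measure_pmf (pmf_of_set ?J) \<Otimes>\<^sub>M unif01) A" .
  qed

  have pmf_mult: "pmf (multinoulli_pmf (?w v) J) i = (if i \<in> J then ?w v i / (\<Sum>j\<in>J. ?w v j) else 0)"
    if "J \<in> ?J" for v J i
    using index_orbit_finite_nonempty[OF that]
    by (intro pmf_multinoulli) (auto simp: boltzmann_weight_pos)
  have law_mult: "distr coupling draw_space (\<lambda>\<omega>. (V \<omega>, I \<omega>, multinoulli_index \<omega>)) = mult_hmc_draw U h k x"
  proof (rule measure_eqI)
    have m: "(\<lambda>v. pmf (multinoulli_pmf (?w v) J) i) \<in> borel_measurable borel" if "J \<in> ?J" for J i
      unfolding pmf_mult[OF that] using w_borel by (cases "i \<in> J") auto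
    have s: "set_pmf (multinoulli_pmf (?w v) J) \<subseteq> J" if "J \<in> ?J" for v J
      by (auto simp: set_pmf_iff pmf_mult[OF that] split: if_splits)
    show "sets (distr coupling draw_space (\<lambda>\<omega>. (V \<omega>, I \<omega>, multinoulli_index \<omega>)))
        = sets (mult_hmc_draw U h k x)"
      unfolding mult_hmc_draw_def sets_distr by (rule sets_hmc_draw[OF m s, symmetric])
    fix A assume "A \<in> sets (distr coupling draw_space (\<lambda>\<omega>. (V \<omega>, I \<omega>, multinoulli_index \<omega>)))"
    then have A: "A \<in> sets draw_space" by simp
    have "emeasure (distr coupling draw_space (\<lambda>\<omega>. (V \<omega>, I \<omega>, multinoulli_index \<omega>))) A
      = (\<integral>\<^sup>+ \<omega>. indicator A (V \<omega>, I \<omega>, multinoulli_index \<omega>) \<partial>coupling)"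
      by (rule emeasure_distr_eq_nn_integral[OF VIL A])
    also have "\<dots> = (\<integral>\<^sup>+ v. (\<Sum>J\<in>?J. ennreal (1 / real (card ?J)) *
        (\<Sum>i\<in>J. ennreal (?w v i / (\<Sum>j\<in>J. ?w v j)) * indicator A (v, J, i))) \<partial>std_gaussian)"
      using nn_integral_coupling_multinoulli[of "\<lambda>v I i. indicator A (v, I, i)"] meas_ind[OF VIL A]
      unfolding V_def I_def measurable_cong_sets[OF sets_coupling refl] by blast
    also have "\<dots> = (\<integral>\<^sup>+ v. (\<Sum>J\<in>?J. ennreal (1 / real (card ?J)) *
        (\<Sum>i\<in>J. ennreal (pmf (multinoulli_pmf (?w v) J) i) * indicator A (v, J, i))) \<partial>std_gaussian)"
      by (intro nn_integral_cong sum.cong refl arg_cong2[where f="(*)"])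
         (simp add: pmf_mult)
    also have "\<dots> = emeasure (mult_hmc_draw U h k x) A"
      unfolding mult_hmc_draw_def by (rule emeasure_hmc_draw[OF m s A, symmetric])
    finally show "emeasure (distr coupling draw_space (\<lambda>\<omega>. (V \<omega>, I \<omega>, multinoulli_index \<omega>))) A
      = emeasure (mult_hmc_draw U h k x) A" .
  qed

  have law_unif: "distr coupling draw_space (\<lambda>\<omega>. (V \<omega>, I \<omega>, uniform_index \<omega>)) = unif_hmc_draw k"
  proof (rule measure_eqI)
    have m: "(\<lambda>v :: real ^ 'd. pmf (pmf_of_set J) i) \<in> borel_measurable borel" for J and i :: int
      by simp
    have s: "set_pmf (pmf_of_set J) \<subseteq> J" if "J \<in> ?J" for J
      using index_orbit_finite_nonempty[OF that] by simp
    show "sets (distr coupling draw_space (\<lambda>\<omega>. (V \<omega>, I \<omega>, uniform_index \<omega>)))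
        = sets (unif_hmc_draw k)"
      unfolding unif_hmc_draw_def sets_distr by (rule sets_hmc_draw[OF m s, symmetric])
    fix A assume "A \<in> sets (distr coupling draw_space (\<lambda>\<omega>. (V \<omega>, I \<omega>, uniform_index \<omega>)))"
    then have A: "A \<in> sets draw_space" by simp
    have "emeasure (distr coupling draw_space (\<lambda>\<omega>. (V \<omega>, I \<omega>, uniform_index \<omega>))) A
      = (\<integral>\<^sup>+ \<omega>. indicator A (V \<omega>, I \<omega>, uniform_index \<omega>) \<partial>coupling)"
      by (rule emeasure_distr_eq_nn_integral[OF VIL' A])
    also have "\<dots> = (\<integral>\<^sup>+ v. (\<Sum>J\<in>?J. ennreal (1 / real (card ?J)) *
        (\<Sum>i\<in>J. ennreal (1 / real (card J)) * indicator A (v, J, i))) \<partial>std_gaussian)"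
      using nn_integral_coupling_uniform[of "\<lambda>v I i. indicator A (v, I, i)"] meas_ind[OF VIL' A]
      unfolding V_def I_def measurable_cong_sets[OF sets_coupling refl] by blast
    also have "\<dots> = (\<integral>\<^sup>+ v. (\<Sum>J\<in>?J. ennreal (1 / real (card ?J)) *
        (\<Sum>i\<in>J. ennreal (pmf (pmf_of_set J) i) * indicator A (v, J, i))) \<partial>std_gaussian)"
      by (intro nn_integral_cong sum.cong refl arg_cong2[where f="(*)"])
         (simp add: index_orbit_finite_nonempty)
    also have "\<dots> = emeasure (unif_hmc_draw k) A"
      unfolding unif_hmc_draw_def by (rule emeasure_hmc_draw[OF m s A, symmetric])
    finally show "emeasure (distr coupling draw_space (\<lambda>\<omega>. (V \<omega>, I \<omega>, uniform_index \<omega>))) A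
      = emeasure (unif_hmc_draw k) A" .
  qed

  \<comment> \<open>The event compares \<open>W\<close> with the overlap, which is the index threshold by definition.\<close>
  have event: "{\<omega> \<in> space coupling. W \<omega> \<le> index_threshold U h x (V \<omega>) (I \<omega>)} \<in> sets coupling"
    using pred_overlap_event
    unfolding index_threshold_def V_def I_def W_def overlap_def pred_def by simp
  have agree: "multinoulli_index \<omega> = uniform_index \<omega>"
    if "W \<omega> \<le> index_threshold U h x (V \<omega>) (I \<omega>)" for \<omega>
    using that unfolding index_threshold_def V_def I_def W_def
    by (simp add: multinoulli_index_def uniform_index_def overlap_def case_prod_beta)

  have "agree_on coupling {\<omega> \<in> space coupling. W \<omega> \<le> index_threshold U h x (V \<omega>) (I \<omega>)}
      (mult_hmc U h k x) (\<lambda>\<omega>. hmc_output U h x (V \<omega>) (multinoulli_index \<omega>))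
      (unif_hmc U h k x) (\<lambda>\<omega>. hmc_output U h x (V \<omega>) (uniform_index \<omega>))"
    unfolding agree_on_def
    using prob_space_coupling event agree
      hmc_output_realizes_law[OF assms(2) VIL law_mult mult_hmc_def]
      hmc_output_realizes_law[OF assms(2) VIL' law_unif unif_hmc_def] by auto
  with prob_space_coupling V I W L L' law_VIW law_mult law_unif show ?thesis
    by blast
qed

end
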